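(* Let $m,n\ge0$ be integers, let $\omega_{m,n}\in\mathbb{R}$, and let $$\mathcal{Y}_{m,n;\omega_{m,n}}(x)=\Phi^{(m+n+1)}(x)+\omega_{m,n}\,\Phi^{(m)}(x)\,\Phi^{(n)}(x),\qquad x\in(0,\infty).$$ Then: (1) the function $(-1)^{m+n+1}\mathcal{Y}_{m,n;\omega_{m,n}}(x)$ is completely monotonic on $(0,\infty)$ if and only if $\omega_{m,n}\le\frac{(m+n+1)!}{m!\,n!}$; (2) the function $(-1)^{m+n}\mathcal{Y}_{m,n;\omega_{m,n}}(x)$ is completely monotonic on $(0,\infty)$ if and only if $\omega_{m,n}\ge\frac{2(m+n+1)!}{m!\,n!}$; (3) the double inequality $$-\frac{2(m+n+1)!}{m!\,n!}<\frac{\Phi^{(m+n+1)}(x)}{\Phi^{(m)}(x)\,\Phi^{(n)}(x)}<-\frac{(m+n+1)!}{m!\,n!}$$ is valid for all $x\in(0,\infty)$ and is sharp in the sense that the lower bound cannot be replaced by any larger number and the upper bound cannot be replaced by any smaller number.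
   Context: $\Gamma(x)=\int_0^\infty t^{x-1}e^{-t}\,dt$ for $x>0$ is Euler's gamma function, $\psi(x)=\frac{\Gamma'(x)}{\Gamma(x)}$ is the digamma function, and $\psi'$ is the trigamma function. Define $\Phi(x)=x\psi'(x)-1$ for $x\in(0,\infty)$; $\Phi^{(k)}$ denotes its $k$-th derivative, with $\Phi^{(0)}=\Phi$. (It is known that for every $k\ge0$ the function $(-1)^k\Phi^{(k)}$ is completely monotonic and positive on $(0,\infty)$, so the denominators do not vanish.) A function $f$ on an interval $I$ is called completely monotonic on $I$ if it has derivatives of all orders on $I$ and $(-1)^k f^{(k)}(t)\ge0$ for all $t\in I$ and all integers $k\ge0$. *)

theory Defs
  imports "HOL-Analysis.Analysis"
begin

(* The library defines Digamma by a series; on the positive reals it is the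
   logarithmic derivative of Gamma. *)
lemma Digamma_eq_deriv_Gamma:
  fixes x :: real
  assumes "x > 0"
  shows "Digamma x = deriv Gamma x / Gamma x"
proof -
  have "x \<notin> \<int>\<^sub>\<le>\<^sub>0"
    using assms by (auto elim!: nonpos_Ints_cases)
  then have "deriv Gamma x = Gamma x * Digamma x"
    by (intro DERIV_imp_deriv has_field_derivative_Gamma)
  moreover have "Gamma x \<noteq> 0"
    using Gamma_real_pos[OF assms] by simp
  ultimately show ?thesis by simp
qed

definition Phi :: "real \<Rightarrow> real" where
  "Phi x = x * deriv Digamma x - 1"

(* deriv is the two-sided derivative, so this is meant for open intervals I,
   on which the iterated derivatives depend only on the values of f in I. *)
definition completely_monotonic_on :: "real set \<Rightarrow> (real \<Rightarrow> real) \<Rightarrow> bool" where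
  "completely_monotonic_on I f \<longleftrightarrow>
     (\<forall>k::nat. \<forall>t\<in>I. (deriv ^^ k) f differentiable at t) \<and>
     (\<forall>k::nat. \<forall>t\<in>I. (-1) ^ k * (deriv ^^ k) f t \<ge> 0)"

definition Y :: "nat \<Rightarrow> nat \<Rightarrow> real \<Rightarrow> real \<Rightarrow> real" where
  "Y m n \<omega> x = (deriv ^^ (m + n + 1)) Phi x + \<omega> * (deriv ^^ m) Phi x * (deriv ^^ n) Phi x"

end

(*
  A_k = (-1)^k Phi^(k) is, up to the factor k!/x^(k+1), the mean E_k of the function
  g(t) = d/dt (t / (1 - exp(-t))) under the Erlang distribution of shape k+1 and rate x.
  Erlang distributions of the same rate are closed under convolution, so E_(m+n+1) is the
  double Erlang mean of g(s+u), to be compared with that of g(s) g(u). Since g increases from 1/2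
  to 1 and 2 g(t) - 1 = (sinh t - t) / (cosh t - 1) is subadditive, g(s) g(u) < g(s+u) < 2 g(s) g(u), which gives (3). The bounds
  are sharp because E_k tends to 1 at 0 and to 1/2 at infinity, and this also yields the necessity
  parts of (1) and (2). For sufficiency put a_mn = m! n!/(m+n+1)!; then a_mn = a_(m+1)n + a_m(n+1),
  so the family V_mn = p a_mn A_(m+n+1) + q A_m A_n satisfies -V_mn' = V_(m+1)n + V_m(n+1), and
  nonnegativity of all its members already implies complete monotonicity.
*)
theory Submission
  imports Defs "HOL-Probability.Probability"
begin

section \<open>Elementary inequalities between sinh, cosh and powers\<close>

lemma nonneg_of_deriv_nonneg:
  fixes f f' :: "real \<Rightarrow> real"
  assumes "\<And>s. 0 \<le> s \<Longrightarrow> (f has_real_derivative f' s) (at s)"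
    and "\<And>s. 0 \<le> s \<Longrightarrow> 0 \<le> f' s" and "0 \<le> f 0" and "0 \<le> t"
  shows "0 \<le> f t"
proof -
  have "f 0 \<le> f t"
    by (rule DERIV_nonneg_imp_nondecreasing[OF assms(4)]) (use assms(1,2) in blast)
  with assms(3) show ?thesis by linarith
qed

lemma self_le_sinh: "0 \<le> t \<Longrightarrow> t \<le> sinh (t::real)"
proof -
  assume t: "0 \<le> t"
  have "0 \<le> sinh t - t"
    by (rule nonneg_of_deriv_nonneg[where f' = "\<lambda>t. cosh t - 1", OF _ _ _ t])
      (auto intro!: derivative_eq_intros cosh_real_ge_1)
  then show ?thesis by simp
qed

lemma half_square_le_cosh: "0 \<le> t \<Longrightarrow> t\<^sup>2 / 2 \<le> cosh (t::real) - 1"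
proof -
  assume t: "0 \<le> t"
  have "0 \<le> cosh t - 1 - t\<^sup>2 / 2"
    by (rule nonneg_of_deriv_nonneg[where f' = "\<lambda>t. sinh t - t", OF _ _ _ t])
      (auto intro!: derivative_eq_intros self_le_sinh)
  then show ?thesis by simp
qed

lemma sinh_le_self_times_cosh: "0 \<le> t \<Longrightarrow> sinh t \<le> t * cosh (t::real)"
proof -
  assume t: "0 \<le> t"
  have "0 \<le> t * cosh t - sinh t"
    by (rule nonneg_of_deriv_nonneg[where f' = "\<lambda>t. t * sinh t", OF _ _ _ t])
      (auto intro!: derivative_eq_intros)
  then show ?thesis by simp
qed

lemma cosh_gt_1: "t \<noteq> 0 \<Longrightarrow> 1 < cosh (t::real)"
  using cosh_real_ge_1[of t] cosh_real_one_iff[of t] by linarith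

section \<open>The ratio (sinh t - t) / (cosh t - 1): bounds, monotonicity, subadditivity\<close>

text \<open>At \<open>t = 0\<close> division by zero gives the value 0, which is also the limit
  there.\<close>

definition sinh_ratio :: "real \<Rightarrow> real" where
  "sinh_ratio t = (sinh t - t) / (cosh t - 1)"

lemma sinh_ratio_pos: "0 < t \<Longrightarrow> 0 < sinh_ratio t"
proof -
  assume t: "0 < t"
  \<comment> \<open>The strict \<open>t < sinh t\<close> comes from the weak inequality at
    \<open>t/2\<close> and the duplication formula; \<open>cosh (t/2) > 1\<close> makes it
    strict.\<close>
  have "sinh (t/2) \<ge> t/2" "cosh (t/2) > 1" using self_le_sinh[of "t/2"] cosh_gt_1[of "t/2"] t by auto
  then have "t/2 * 1 < sinh (t/2) * cosh (t/2)" using t by (intro mult_le_less_imp_less) auto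
  then have "t < sinh t" using sinh_double[of "t/2"] by simp
  then show ?thesis using cosh_gt_1[of t] t by (simp add: sinh_ratio_def)
qed

text \<open>Clearing the denominator leaves \<open>1 - t < exp (- t)\<close>, because cosh t - sinh
  t = exp (-t).\<close>

lemma sinh_ratio_lt_1: "0 < t \<Longrightarrow> sinh_ratio t < 1"
  using cosh_gt_1[of t] exp_minus_greater[of t] cosh_minus_sinh[of t]
  by (simp add: sinh_ratio_def divide_less_eq)

text \<open>The two signs amount to 1 - t \<le> exp (-t) and 1 + t \<le> exp t. Having the bound on
  the whole line makes the kernel a bounded function, hence integrable for every probability measure
  used below.\<close>

lemma abs_sinh_ratio_le_1: "\<bar>sinh_ratio t\<bar> \<le> 1"
proof -
  have "\<bar>sinh t - t\<bar> \<le> cosh t - 1"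
    using exp_ge_add_one_self[of t] exp_ge_add_one_self[of "-t"]
      cosh_minus_sinh[of t] cosh_plus_sinh[of t] by linarith
  then show ?thesis
    by (cases "t = 0") (use cosh_gt_1[of t] in \<open>auto simp: sinh_ratio_def divide_le_eq_1\<close>)
qed

lemma sinh_ratio_le_self:
  assumes "0 < t"
  shows "sinh_ratio t \<le> t"
  using sinh_le_self_times_cosh[of t] cosh_gt_1[of t] assms
  by (simp add: sinh_ratio_def divide_le_eq right_diff_distrib)

text \<open>With cosh^2 - sinh^2 = 1 the numerator of the derivative becomes 2 - 2 cosh t + t sinh
  t, which vanishes at 0 and has the nonnegative derivative t cosh t - sinh t.\<close>

lemma sinh_ratio_mono:
  assumes "0 < a" "a \<le> b"
  shows "sinh_ratio a \<le> sinh_ratio b"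
proof (rule DERIV_nonneg_imp_nondecreasing[OF assms(2)])
  fix t assume "a \<le> t" "t \<le> b"
  with assms have t: "0 < t" by simp
  have C: "cosh t > 1" using cosh_gt_1 t by simp
  have "(sinh_ratio has_real_derivative (2 - 2 * cosh t + t * sinh t) / (cosh t - 1)\<^sup>2) (at t)"
    unfolding sinh_ratio_def using C cosh_square_eq[of t]
    by (auto intro!: derivative_eq_intros) (simp add: power2_eq_square algebra_simps)
  moreover have "0 \<le> 2 - 2 * cosh t + t * sinh t"
    by (rule nonneg_of_deriv_nonneg[where f' = "\<lambda>t. t * cosh t - sinh t"])
      (use t in \<open>auto intro!: derivative_eq_intros sinh_le_self_times_cosh\<close>)
  ultimately show "\<exists>y. (sinh_ratio has_real_derivative y) (at t) \<and> 0 \<le> y" by force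
qed

lemma sinh_ratio_div_self_antimono:
  assumes "0 < a" "a \<le> b"
  shows "sinh_ratio b / b \<le> sinh_ratio a / a"
proof (rule DERIV_nonpos_imp_nonincreasing[OF assms(2)])
  fix t assume "a \<le> t" "t \<le> b"
  with assms have t: "0 < t" by simp
  have C: "cosh t > 1" using cosh_gt_1 t by simp
  \<comment> \<open>\<open>- D\<close> is the numerator of the derivative of
    \<open>sinh_ratio t / t\<close>, after cancelling. The expressions in \<open>E0\<close>,
    \<open>E1\<close>, \<open>E2\<close> are the first three derivatives of \<open>D\<close>; since
    \<open>D\<close> and the first two derivatives vanish at 0, nonnegativity descends from
    \<open>E2\<close> to \<open>D\<close>.\<close>
  define D :: "real \<Rightarrow> real" where "D s = sinh s * cosh s - sinh s + s * cosh s - s - s\<^sup>2 * sinh s" for s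
  have E2: "0 \<le> 4 * (cosh s)\<^sup>2 + 4 * (sinh s)\<^sup>2 - 4 * cosh s - 5 * (s * sinh s) - s\<^sup>2 * cosh s"
    if s: "0 \<le> s" for s :: real
  proof -
    \<comment> \<open>After these two estimates and sinh^2 = cosh^2 - 1, what remains is exactly
      (cosh s - 1)^2.\<close>
    have "s * sinh s \<le> (sinh s)\<^sup>2"
      using self_le_sinh[OF s] s by (simp add: power2_eq_square mult_right_mono)
    moreover have "s\<^sup>2 * cosh s \<le> 2 * (cosh s - 1) * cosh s"
      using half_square_le_cosh[OF s] by (intro mult_right_mono) auto
    moreover have "0 \<le> (cosh s - 1)\<^sup>2" by simp
    ultimately show ?thesis using cosh_square_eq[of s]
      by (simp add: power2_eq_square algebra_simps)
  qed
  have E1: "0 \<le> 4 * (sinh s * cosh s) - sinh s - 3 * (s * cosh s) - s\<^sup>2 * sinh s" if "0 \<le> s" for s :: real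
    by (rule nonneg_of_deriv_nonneg[OF _ E2 _ that])
      (auto intro!: derivative_eq_intros simp: power2_eq_square algebra_simps)
  have E0: "0 \<le> 2 * (sinh s)\<^sup>2 - s * sinh s - s\<^sup>2 * cosh s" if "0 \<le> s" for s :: real
    by (rule nonneg_of_deriv_nonneg[OF _ E1 _ that])
      (auto intro!: derivative_eq_intros simp: power2_eq_square algebra_simps)
  have D: "0 \<le> D t"
    unfolding D_def
    by (rule nonneg_of_deriv_nonneg[OF _ E0])
      (use t in \<open>auto intro!: derivative_eq_intros simp: cosh_square_eq[unfolded power2_eq_square] power2_eq_square algebra_simps\<close>)
  define c where "c = cosh t - 1"
  have c: "c > 0" using C by (simp add: c_def)
  have "((\<lambda>t. sinh_ratio t / t) has_real_derivative
      (c * (c * t) - (sinh t - t) * (sinh t * t + c)) / (c * t * (c * t))) (at t)"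
    unfolding sinh_ratio_def c_def divide_divide_eq_left using C t
    by (auto intro!: derivative_eq_intros)
  also have "c * (c * t) - (sinh t - t) * (sinh t * t + c) = - D t"
  proof -
    have "cosh t * cosh t = sinh t * sinh t + 1"
      using cosh_square_eq[of t] by (simp add: power2_eq_square)
    then show ?thesis unfolding c_def D_def power2_eq_square by algebra
  qed
  finally have "((\<lambda>t. sinh_ratio t / t) has_real_derivative - D t / (c * t * (c * t))) (at t)" .
  moreover have "- D t / (c * t * (c * t)) \<le> 0" using D by simp
  ultimately show "\<exists>y. ((\<lambda>t. sinh_ratio t / t) has_real_derivative y) (at t) \<and> y \<le> 0" by blast
qed

text \<open>A function whose quotient by t decreases is subadditive: split the value at
  \<open>s + u\<close> into shares proportional to \<open>s\<close> and \<open>u\<close>, then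
  compare the quotients.\<close>

lemma sinh_ratio_subadditive:
  assumes "0 < s" "0 < u"
  shows "sinh_ratio (s + u) \<le> sinh_ratio s + sinh_ratio u"
proof -
  let ?r = "\<lambda>t. sinh_ratio t / t"
  have "sinh_ratio (s + u) = s * ?r (s + u) + u * ?r (s + u)"
    using assms by (simp add: add_divide_distrib[symmetric] distrib_right[symmetric])
  also have "\<dots> \<le> s * ?r s + u * ?r u"
    using assms by (intro add_mono mult_left_mono sinh_ratio_div_self_antimono) auto
  finally show ?thesis using assms by simp
qed

section \<open>The kernel g and its comparison with products\<close>

text \<open>For t > 0 this is the derivative of t / (1 - exp (-t)), as shown in
  \<open>has_real_derivative_Phi_kernel\<close>. The form through \<open>sinh_ratio\<close> makes
  the bounds and both product inequalities short.\<close>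

definition Phi_kernel :: "real \<Rightarrow> real" where
  "Phi_kernel t = (1 + sinh_ratio t) / 2"

lemma Phi_kernel_measurable [measurable]: "Phi_kernel \<in> borel_measurable borel"
  unfolding Phi_kernel_def[abs_def] sinh_ratio_def sinh_field_def cosh_field_def by measurable

lemma abs_Phi_kernel_le_1: "\<bar>Phi_kernel t\<bar> \<le> 1"
  using abs_sinh_ratio_le_1[of t] by (simp add: Phi_kernel_def)

lemma Phi_kernel_bounds: "0 < t \<Longrightarrow> 1 / 2 < Phi_kernel t \<and> Phi_kernel t < 1 \<and> Phi_kernel t \<le> 1 / 2 + t / 2"
  using sinh_ratio_pos[of t] sinh_ratio_lt_1[of t] sinh_ratio_le_self[of t] by (simp add: Phi_kernel_def)

lemma Phi_kernel_mult_less: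
  assumes "0 < s" "0 < u"
  shows "Phi_kernel s * Phi_kernel u < Phi_kernel (s + u)"
proof -
  have "Phi_kernel s * Phi_kernel u < Phi_kernel s * 1"
    using Phi_kernel_bounds[of s] Phi_kernel_bounds[of u] assms by (intro mult_strict_left_mono) auto
  also have "\<dots> \<le> Phi_kernel (s + u)"
    using sinh_ratio_mono[of s "s + u"] assms by (simp add: Phi_kernel_def)
  finally show ?thesis .
qed

text \<open>With r = \<open>sinh_ratio\<close>, twice the difference of the two sides is r(s) + r(u)
  - r(s + u) + r(s) r(u). Subadditivity handles the first three terms and the positive product gives
  strictness.\<close>

lemma Phi_kernel_less_twice_mult:
  assumes "0 < s" "0 < u"
  shows "Phi_kernel (s + u) < 2 * (Phi_kernel s * Phi_kernel u)"
proof -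
  have "0 < sinh_ratio s * sinh_ratio u"
    using assms by (simp add: sinh_ratio_pos)
  with sinh_ratio_subadditive[OF assms] show ?thesis
    by (simp add: Phi_kernel_def field_simps)
qed

section \<open>Means of the kernel under Erlang distributions\<close>

text \<open>The index is the shape minus one, so adding shapes j + 1 and k + 1 gives index j + k +
  1.\<close>

abbreviation erlang :: "nat \<Rightarrow> real \<Rightarrow> real measure" where
  "erlang k l \<equiv> density lborel (\<lambda>t. ennreal (erlang_density k l t))"

lemma convolution_erlang:
  assumes l: "0 < l"
  shows "erlang j l \<star> erlang k l = erlang (j + k + 1) l"
proof -
  have fin: "finite_measure (erlang i l)" for i
    using prob_space_erlang_density[OF l, of i] by (simp add: prob_space_def)
  have "erlang j l \<star> erlang k l =
      density lborel (\<lambda>x. \<integral>\<^sup>+y. ennreal (erlang_density j l (x - y)) * ennreal (erlang_density k l y) \<partial>lborel)"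
    by (rule convolution_density) (simp_all add: fin)
  also have "\<dots> = erlang (j + k + 1) l"
    using convolution_erlang_density[OF l, of j k] by simp
  finally show ?thesis .
qed

text \<open>The convolution is the image of the product measure under addition; Fubini applies
  because \<open>f\<close> is bounded.\<close>

lemma integral_erlang_sum:
  fixes f :: "real \<Rightarrow> real"
  assumes l: "0 < l" and [measurable]: "f \<in> borel_measurable borel" and B: "\<And>t. \<bar>f t\<bar> \<le> B"
  shows "(\<integral>t. f t \<partial>erlang (j + k + 1) l) = (\<integral>s. \<integral>u. f (s + u) \<partial>erlang k l \<partial>erlang j l)"
proof -
  interpret J: prob_space "erlang j l" by (rule prob_space_erlang_density[OF l])
  interpret K: prob_space "erlang k l" by (rule prob_space_erlang_density[OF l])
  interpret pair_prob_space "erlang j l" "erlang k l" ..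
  have "(\<integral>t. f t \<partial>erlang (j + k + 1) l) = (\<integral>z. f (fst z + snd z) \<partial>(erlang j l \<Otimes>\<^sub>M erlang k l))"
    unfolding convolution_erlang[OF l, symmetric] convolution_def
    by (subst integral_distr) (auto simp: case_prod_beta)
  also have "\<dots> = (\<integral>s. \<integral>u. f (s + u) \<partial>erlang k l \<partial>erlang j l)"
    by (subst integral_fst'[symmetric]) (auto intro!: P.integrable_const_bound[where B = B] B)
  finally show ?thesis .
qed

lemma AE_erlang_pos: "AE t in erlang k l. 0 < t"
proof -
  \<comment> \<open>For \<open>k = 0\<close> the density may be positive at 0, so this point is
    discarded as a null set.\<close>
  have "AE t in lborel. t \<noteq> (0::real)" by (rule AE_lborel_singleton)
  then have "AE t in lborel. 0 < ennreal (erlang_density k l t) \<longrightarrow> 0 < t"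
    by eventually_elim (auto simp: erlang_density_def split: if_splits)
  then show ?thesis by (subst AE_density) auto
qed

definition erlang_mean :: "nat \<Rightarrow> real \<Rightarrow> real" where
  "erlang_mean k x = (\<integral>t. Phi_kernel t \<partial>erlang k x)"

text \<open>The kernel lies between 1/2 and 1/2 + t/2 for t > 0, and the mean of t is (k + 1)/x. The
  lower bound gives positivity; both together give the limit 1/2 at infinity.\<close>

lemma erlang_mean_bounds:
  assumes x: "0 < x"
  shows "1 / 2 \<le> erlang_mean k x" "erlang_mean k x \<le> 1 / 2 + real (k + 1) / (2 * x)"
proof -
  interpret prob_space "erlang k x" by (rule prob_space_erlang_density[OF x])
  have int: "integrable (erlang k x) Phi_kernel"
    by (rule integrable_const_bound[where B = 1]) (auto simp: abs_Phi_kernel_le_1)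
  have prob_UNIV: "prob UNIV = 1" using prob_space by simp
  have nn: "(\<integral>\<^sup>+ t. ennreal (erlang_density k x t * t) \<partial>lborel) = ennreal (real (k + 1) / x)"
    using nn_integral_erlang_ith_moment[OF x, of k 1] by simp
  have "has_bochner_integral lborel (\<lambda>t. erlang_density k x t * t) (real (k + 1) / x)"
    using x by (intro has_bochner_integral_nn_integral nn) (auto simp: erlang_density_def)
  then have id: "has_bochner_integral (erlang k x) (\<lambda>t. t) (real (k + 1) / x)"
    using x by (subst has_bochner_integral_density) auto
  have "(\<integral>t. 1 / 2 \<partial>erlang k x) \<le> erlang_mean k x"
    unfolding erlang_mean_def using AE_erlang_pos[of k x]
    by (intro integral_mono_AE int) (auto elim!: eventually_mono dest: Phi_kernel_bounds)
  then show "1 / 2 \<le> erlang_mean k x" by (simp add: prob_UNIV)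
  have "erlang_mean k x \<le> (\<integral>t. 1 / 2 + t / 2 \<partial>erlang k x)"
    unfolding erlang_mean_def using AE_erlang_pos[of k x] integrable.intros[OF id]
    by (intro integral_mono_AE int integrable_add integrable_divide)
      (auto elim!: eventually_mono dest: Phi_kernel_bounds)
  also have "\<dots> = 1 / 2 + (real (k + 1) / x) / 2"
    using id by (simp add: has_bochner_integral_iff prob_UNIV)
  finally show "erlang_mean k x \<le> 1 / 2 + real (k + 1) / (2 * x)" by (simp add: mult.commute)
qed

text \<open>A strict inequality that holds almost everywhere for a probability measure stays strict
  after integration; this is applied first to the inner and then to the outer integral.\<close>

lemma double_integral_erlang_less:
  fixes f g :: "real \<Rightarrow> real \<Rightarrow> real"
  assumes l: "0 < l"
    and [measurable]: "case_prod f \<in> borel_measurable (borel \<Otimes>\<^sub>M borel)"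
      "case_prod g \<in> borel_measurable (borel \<Otimes>\<^sub>M borel)"
    and f: "\<And>s u. \<bar>f s u\<bar> \<le> B" and g: "\<And>s u. \<bar>g s u\<bar> \<le> B"
    and less: "\<And>s u. 0 < s \<Longrightarrow> 0 < u \<Longrightarrow> f s u < g s u"
  shows "(\<integral>s. \<integral>u. f s u \<partial>erlang k l \<partial>erlang j l) < (\<integral>s. \<integral>u. g s u \<partial>erlang k l \<partial>erlang j l)"
proof -
  interpret J: prob_space "erlang j l" by (rule prob_space_erlang_density[OF l])
  interpret K: prob_space "erlang k l" by (rule prob_space_erlang_density[OF l])
  interpret pair_prob_space "erlang j l" "erlang k l" ..
  have inner: "integrable (erlang k l) (\<lambda>u. f s u)" "integrable (erlang k l) (\<lambda>u. g s u)" for s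
    by (auto intro!: K.integrable_const_bound[where B = B] simp: f g)
  have outer: "integrable (erlang j l) (\<lambda>s. \<integral>u. f s u \<partial>erlang k l)"
    "integrable (erlang j l) (\<lambda>s. \<integral>u. g s u \<partial>erlang k l)"
    by (intro integrable_fst P.integrable_const_bound[where B = B]; simp add: f g case_prod_beta)+
  show ?thesis
  proof (rule J.integral_less_AE_space[OF outer])
    have "(\<integral>u. f s u \<partial>erlang k l) < (\<integral>u. g s u \<partial>erlang k l)" if "0 < s" for s
      using AE_erlang_pos[of k l] less[OF that] K.emeasure_space_1
      by (intro K.integral_less_AE_space inner) (auto elim!: eventually_mono)
    then show "AE s in erlang j l. (\<integral>u. f s u \<partial>erlang k l) < (\<integral>u. g s u \<partial>erlang k l)"
      using AE_erlang_pos[of j l] by (auto elim!: eventually_mono)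
  qed (use J.emeasure_space_1 in auto)
qed

lemma erlang_mean_sum_bounds:
  assumes x: "0 < x"
  shows "erlang_mean m x * erlang_mean n x < erlang_mean (m + n + 1) x"
    and "erlang_mean (m + n + 1) x < 2 * (erlang_mean m x * erlang_mean n x)"
proof -
  have prod: "(\<integral>s. \<integral>u. Phi_kernel s * Phi_kernel u \<partial>erlang n x \<partial>erlang m x) = erlang_mean m x * erlang_mean n x"
    by (simp add: erlang_mean_def)
  have sum: "(\<integral>s. \<integral>u. Phi_kernel (s + u) \<partial>erlang n x \<partial>erlang m x) = erlang_mean (m + n + 1) x"
    unfolding erlang_mean_def
    by (rule integral_erlang_sum[symmetric, OF x _ abs_Phi_kernel_le_1]) simp
  have bound: "\<bar>Phi_kernel s * Phi_kernel u\<bar> \<le> 1" for s u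
    using mult_mono[OF abs_Phi_kernel_le_1[of s] abs_Phi_kernel_le_1[of u]] by (simp add: abs_mult)
  have "(\<integral>s. \<integral>u. Phi_kernel s * Phi_kernel u \<partial>erlang n x \<partial>erlang m x)
      < (\<integral>s. \<integral>u. Phi_kernel (s + u) \<partial>erlang n x \<partial>erlang m x)"
    by (rule double_integral_erlang_less[OF x, where B = 1])
      (simp_all add: bound abs_Phi_kernel_le_1 Phi_kernel_mult_less)
  then show "erlang_mean m x * erlang_mean n x < erlang_mean (m + n + 1) x"
    by (simp only: prod sum)
  have "(\<integral>s. \<integral>u. Phi_kernel (s + u) \<partial>erlang n x \<partial>erlang m x)
      < (\<integral>s. \<integral>u. 2 * (Phi_kernel s * Phi_kernel u) \<partial>erlang n x \<partial>erlang m x)"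
  proof (rule double_integral_erlang_less[OF x, where B = 2])
    show "\<bar>Phi_kernel (s + u)\<bar> \<le> 2" for s u using abs_Phi_kernel_le_1[of "s + u"] by linarith
    show "\<bar>2 * (Phi_kernel s * Phi_kernel u)\<bar> \<le> 2" for s u using bound[of s u] by linarith
  qed (simp_all add: Phi_kernel_less_twice_mult)
  then show "erlang_mean (m + n + 1) x < 2 * (erlang_mean m x * erlang_mean n x)"
    using prod sum by simp
qed

section \<open>From Polygamma functions to Erlang means\<close>

text \<open>The right-hand side is what the quotient rule yields for t / (1 - exp (-t)). In the
  variable e = exp t the identity is rational, with e + 1/e - 2 = (e - 1)^2 / e.\<close>

lemma Phi_kernel_conv_exp:
  assumes "0 < t"
  shows "Phi_kernel t = (1 - exp (- t) - t * exp (- t)) / (1 - exp (- t))\<^sup>2"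
proof -
  define e where "e = exp t"
  have e: "e > 1" using assms by (simp add: e_def)
  then have q: "e + 1 / e - 2 = (e - 1)\<^sup>2 / e"
    by (simp add: field_simps power2_eq_square)
  have "sinh t - t = (e - 1 / e - 2 * t) / 2" "cosh t - 1 = (e + 1 / e - 2) / 2"
    by (simp_all add: sinh_field_def cosh_field_def e_def exp_minus inverse_eq_divide)
  then have "sinh_ratio t = ((e - 1 / e - 2 * t) / 2) / ((e + 1 / e - 2) / 2)"
    unfolding sinh_ratio_def by (simp only:)
  moreover have "(a / 2) / (b / 2) = a / b" for a b :: real by simp
  ultimately have "Phi_kernel t = (1 + (e - 1 / e - 2 * t) / (e + 1 / e - 2)) / 2"
    unfolding Phi_kernel_def by (simp only:)
  also have "\<dots> = (1 + (e * e - 1 - 2 * t * e) / (e - 1)\<^sup>2) / 2"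
    unfolding q using e by (simp add: left_diff_distrib)
  also have "\<dots> = (e * e - e - t * e) / (e - 1)\<^sup>2"
  proof -
    have *: "(1 + a / d) / 2 = b / d" if "d \<noteq> 0" "d + a = 2 * b" for a b d :: real
      using that by (simp add: field_simps)
    show ?thesis
      by (rule *) (use e in simp, simp add: power2_eq_square algebra_simps)
  qed
  also have "\<dots> = (1 - 1 / e - t * (1 / e)) / (1 - 1 / e)\<^sup>2"
  proof -
    have "1 - 1 / e = (e - 1) / e" using e by (simp add: field_simps)
    then have "(1 - 1 / e)\<^sup>2 = (e - 1)\<^sup>2 / (e * e)" by (simp add: power_divide power2_eq_square)
    then show ?thesis using e by (simp add: left_diff_distrib)
  qed
  finally show ?thesis by (simp add: e_def exp_minus inverse_eq_divide)
qed

lemma has_real_derivative_Phi_kernel: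
  assumes "0 < t"
  shows "((\<lambda>t. t / (1 - exp (- t))) has_real_derivative Phi_kernel t) (at t)"
  unfolding Phi_kernel_conv_exp[OF assms] using assms
  by (auto intro!: derivative_eq_intros simp: power2_eq_square)

text \<open>Expand 1 / (1 - exp (-t)) as a geometric series in exp (-t) and integrate termwise; the
  terms k! / (x + j)^(k+1) sum to the Polygamma series.\<close>

lemma integral_power_exp_Polygamma:
  fixes x :: real
  assumes x: "0 < x" and k: "0 < k"
  shows "set_integrable lborel {0<..} (\<lambda>t. t ^ k / (1 - exp (- t)) * exp (- x * t))"
    and "(LBINT t:{0<..}. t ^ k / (1 - exp (- t)) * exp (- x * t)) = (-1) ^ Suc k * Polygamma k x"
proof -
  \<comment> \<open>The j-th term t^k exp (-(x + j) t), written as a multiple of an Erlang density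
    of rate \<open>x + j\<close> so that its integral is known. As \<open>k > 0\<close>, it vanishes
    at \<open>t = 0\<close>.\<close>
  define f where "f j t = fact k / (x + real j) ^ Suc k * erlang_density k (x + real j) t" for j t
  have pos: "0 < x + real j" for j using x by simp
  have f_eq: "f j t = indicator {0<..} t * (t ^ k * exp (- x * t) * exp (- t) ^ j)" for j t
  proof (cases "0 < t")
    case True
    have "exp ((- x - real j) * t) = exp (- x * t) * exp (- t) ^ j"
      by (simp add: exp_of_nat_mult[symmetric] mult_exp_exp algebra_simps)
    with True show ?thesis
      using pos[of j] by (simp add: f_def erlang_density_def)
  qed (use k in \<open>auto simp: f_def erlang_density_def\<close>)
  have f_int: "has_bochner_integral lborel (f j) (fact k / (x + real j) ^ Suc k)" for j
  proof -
    have "has_bochner_integral lborel (erlang_density k (x + real j)) 1"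
      using nn_integral_erlang_ith_moment[OF pos, of k j 0] pos[of j]
      by (intro has_bochner_integral_nn_integral) auto
    then have "has_bochner_integral lborel (f j) (fact k / (x + real j) ^ Suc k * 1)"
      unfolding f_def by (rule has_bochner_integral_mult_right)
    then show ?thesis by simp
  qed
  have f_nonneg: "0 \<le> f j t" for j t
    using pos[of j] by (simp add: f_def)
  have f_sums: "(\<lambda>j. f j t) sums (indicator {0<..} t *\<^sub>R (t ^ k / (1 - exp (- t)) * exp (- x * t)))" for t
  proof (cases "0 < t")
    case True
    then have "(\<lambda>j. t ^ k * exp (- x * t) * exp (- t) ^ j) sums (t ^ k * exp (- x * t) * (1 / (1 - exp (- t))))"
      by (intro sums_mult geometric_sums) auto
    with True show ?thesis by (simp add: f_eq)
  qed (simp add: f_eq)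
  have "(\<lambda>j. inverse ((x + real j) ^ Suc k)) sums ((-1) ^ Suc k * Polygamma k x / fact k)"
    using Polygamma_LIMSEQ[of x k] x k by simp
  from sums_mult[OF this, of "fact k"]
  have int_sums: "(\<lambda>j. integral\<^sup>L lborel (f j)) sums ((-1) ^ Suc k * Polygamma k x)"
    by (simp add: has_bochner_integral_integral_eq[OF f_int] inverse_eq_divide)
  have *: "(\<lambda>t. \<Sum>j. f j t) = (\<lambda>t. indicator {0<..} t *\<^sub>R (t ^ k / (1 - exp (- t)) * exp (- x * t)))"
    using f_sums by (auto simp: sums_iff)
  have A: "integrable lborel (f j)" for j
    by (rule integrable.intros[OF f_int])
  have B: "AE t in lborel. summable (\<lambda>j. norm (f j t))"
    using f_sums f_nonneg by (auto simp: sums_iff)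
  have C: "summable (\<lambda>j. \<integral>t. norm (f j t) \<partial>lborel)"
    using int_sums f_nonneg by (simp add: sums_iff)
  show "set_integrable lborel {0<..} (\<lambda>t. t ^ k / (1 - exp (- t)) * exp (- x * t))"
    using integrable_suminf[OF A B C] by (simp add: * set_integrable_def)
  show "(LBINT t:{0<..}. t ^ k / (1 - exp (- t)) * exp (- x * t)) = (-1) ^ Suc k * Polygamma k x"
    using sums_unique2[OF sums_integral[OF A B C] int_sums] by (simp add: * set_lebesgue_integral_def)
qed

lemma integral_power_exp_Phi_kernel:
  assumes x: "0 < x"
  shows "set_integrable lborel {0<..} (\<lambda>t. t ^ k * exp (- x * t) * Phi_kernel t)"
    and "(LBINT t:{0<..}. t ^ k * exp (- x * t) * Phi_kernel t) = fact k / x ^ Suc k * erlang_mean k x"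
proof -
  interpret prob_space "erlang k x" by (rule prob_space_erlang_density[OF x])
  have "integrable (erlang k x) Phi_kernel"
    by (rule integrable_const_bound[where B = 1]) (auto simp: abs_Phi_kernel_le_1)
  then have "has_bochner_integral lborel (\<lambda>t. erlang_density k x t *\<^sub>R Phi_kernel t) (erlang_mean k x)"
    unfolding has_bochner_integral_iff erlang_mean_def
    using x by (subst (asm) integrable_density) (auto simp: integral_density)
  then have "has_bochner_integral lborel (\<lambda>t. fact k / x ^ Suc k * (erlang_density k x t * Phi_kernel t))
      (fact k / x ^ Suc k * erlang_mean k x)"
    by (intro has_bochner_integral_mult_right) simp
  moreover have "AE t in lborel. fact k / x ^ Suc k * (erlang_density k x t * Phi_kernel t) =
      indicator {0<..} t *\<^sub>R (t ^ k * exp (- x * t) * Phi_kernel t)"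
    using AE_lborel_singleton[of 0] by eventually_elim (use x in \<open>auto simp: erlang_density_def indicator_def\<close>)
  ultimately have "has_bochner_integral lborel (\<lambda>t. indicator {0<..} t *\<^sub>R (t ^ k * exp (- x * t) * Phi_kernel t))
      (fact k / x ^ Suc k * erlang_mean k x)"
    by (subst (asm) has_bochner_integral_cong_AE) auto
  then show "set_integrable lborel {0<..} (\<lambda>t. t ^ k * exp (- x * t) * Phi_kernel t)"
    "(LBINT t:{0<..}. t ^ k * exp (- x * t) * Phi_kernel t) = fact k / x ^ Suc k * erlang_mean k x"
    by (simp_all add: has_bochner_integral_iff set_integrable_def set_lebesgue_integral_def)
qed

lemma tendsto_power_times_exp_at_top:
  fixes x :: real
  assumes x: "0 < x"
  shows "((\<lambda>t. t ^ k * exp (- x * t)) \<longlongrightarrow> 0) at_top"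
proof -
  have "filterlim (\<lambda>t. x * t) at_top at_top"
    using x by (rule filterlim_tendsto_pos_mult_at_top[OF tendsto_const _ filterlim_ident])
  then have "((\<lambda>t. (x * t) ^ k / exp (x * t) / x ^ k) \<longlongrightarrow> 0 / x ^ k) at_top"
    by (intro tendsto_divide tendsto_const filterlim_compose[OF tendsto_power_div_exp_0]) (use x in auto)
  moreover have "(x * t) ^ k / exp (x * t) / x ^ k = t ^ k * exp (- x * t)" for t
    using x by (simp add: power_mult_distrib exp_minus divide_inverse)
  ultimately show ?thesis by simp
qed

text \<open>The left side is the k-th derivative of x psi'(x) - 1. The identity is an integration by
  parts: \<open>f\<close> is the derivative of \<open>F\<close>, and its integral over the half-line
  is a boundary term. \<open>F\<close> tends to 0 at infinity, and at 0 it tends to 1 if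
  \<open>k = 0\<close> and to 0 otherwise; this accounts for the constant -1 in
  \<open>Phi\<close>.\<close>

lemma Polygamma_erlang_mean:
  assumes x: "0 < x"
  shows "x * Polygamma (Suc k) x + real k * Polygamma k x - (if k = 0 then 1 else 0) =
    (-1) ^ k * fact k / x ^ Suc k * erlang_mean k x"
proof -
  define p where "p j t = t ^ j / (1 - exp (- t)) * exp (- x * t)" for j and t :: real
  define F where "F t = t ^ k * exp (- x * t) * (t / (1 - exp (- t)))" for t :: real
  define f where "f t = real k * p k t + t ^ k * exp (- x * t) * Phi_kernel t - x * p (Suc k) t" for t
  have p: "set_integrable lborel {0<..} (p j)"
    "(LBINT t:{0<..}. p j t) = (-1) ^ Suc j * Polygamma j x" if "0 < j" for j
    unfolding p_def by (fact integral_power_exp_Polygamma[OF x that])+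
  \<comment> \<open>The function \<open>p 0\<close> behaves like 1/t near 0 and is not integrable.
    For \<open>k = 0\<close> it occurs only with the coefficient \<open>real k = 0\<close>, which
    the alternative \<open>c = 0\<close> covers.\<close>
  have p_int: "set_integrable lborel {0<..} (\<lambda>t. c * p j t)"
    "(LBINT t:{0<..}. c * p j t) = c * ((-1) ^ Suc j * Polygamma j x)" if "0 < j \<or> c = 0" for j c
  proof -
    have "set_integrable lborel {0<..} (\<lambda>t. c * p j t) \<and>
      (LBINT t:{0<..}. c * p j t) = c * ((-1) ^ Suc j * Polygamma j x)"
    proof (cases "c = 0")
      case True
      then show ?thesis by (simp add: set_integrable_def set_lebesgue_integral_def)
    next
      case False
      with that have j: "0 < j" by simp
      show ?thesis
        by (simp only: set_integral_mult_right p(2)[OF j]) (simp add: set_integrable_mult_right p(1)[OF j])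
    qed
    then show "set_integrable lborel {0<..} (\<lambda>t. c * p j t)"
      "(LBINT t:{0<..}. c * p j t) = c * ((-1) ^ Suc j * Polygamma j x)" by blast+
  qed
  have p_k: "0 < k \<or> real k = 0" "0 < Suc k \<or> x = 0" by auto
  note p_int = p_int[OF p_k(1)] p_int[OF p_k(2)]
  have f_int: "set_integrable lborel {0<..} f"
    unfolding f_def[abs_def] by (intro set_integral_diff set_integral_add p_int integral_power_exp_Phi_kernel x)
  have "(LBINT t:{0<..}. f t) = real k * ((-1) ^ Suc k * Polygamma k x) +
      fact k / x ^ Suc k * erlang_mean k x - x * ((-1) ^ Suc (Suc k) * Polygamma (Suc k) x)"
    unfolding f_def
    by (simp only: set_integral_diff set_integral_add p_int integral_power_exp_Phi_kernel[OF x])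
  moreover have "(LBINT t=0..\<infinity>. f t) = 0 - (if k = 0 then 1 else 0)"
  proof (rule interval_integral_FTC_integrable[where F = F])
    fix t assume "0 < ereal t"
    then have t: "0 < t" by simp
    have "((\<lambda>t. t ^ k * exp (- x * t)) has_real_derivative
        (real k * t ^ (k - 1) - x * t ^ k) * exp (- x * t)) (at t)"
      by (auto intro!: derivative_eq_intros simp: algebra_simps)
    from DERIV_mult[OF this has_real_derivative_Phi_kernel[OF t]]
    have "(F has_real_derivative (real k * t ^ (k - 1) - x * t ^ k) * exp (- x * t) * (t / (1 - exp (- t)))
        + Phi_kernel t * (t ^ k * exp (- x * t))) (at t)"
      unfolding F_def .
    also have "(real k * t ^ (k - 1) - x * t ^ k) * exp (- x * t) * (t / (1 - exp (- t)))
        + Phi_kernel t * (t ^ k * exp (- x * t)) = f t"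
      unfolding f_def p_def by (cases k) (simp_all add: algebra_simps diff_divide_distrib add_divide_distrib)
    finally have "(F has_real_derivative f t) (at t)" .
    then show "(F has_vector_derivative f t) (at t)"
      by (simp add: has_real_derivative_iff_has_vector_derivative)
    have "isCont (\<lambda>t. sinh_ratio t) t"
      unfolding sinh_ratio_def using cosh_gt_1[of t] t by (intro continuous_intros) auto
    then show "isCont f t"
      unfolding f_def p_def Phi_kernel_def using t by (intro continuous_intros) auto
  next
    show "set_integrable lborel (einterval 0 \<infinity>) f"
      using f_int by (simp add: zero_ereal_def)
    have "((\<lambda>t::real. t / (1 - exp (- t))) \<longlongrightarrow> 1) (at_right 0)" by real_asymp
    then have "(F \<longlongrightarrow> 0 ^ k * exp (- x * 0) * 1) (at_right 0)"
      unfolding F_def by (intro tendsto_intros)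
    then show "((F \<circ> real_of_ereal) \<longlongrightarrow> (if k = 0 then 1 else 0)) (at_right 0)"
      by (simp add: zero_ereal_def ereal_tendsto_simps power_0_left)
    have "((\<lambda>t. t ^ Suc k * exp (- x * t) * (1 / (1 - exp (- t)))) \<longlongrightarrow> 0 * 1) at_top"
      by (intro tendsto_mult tendsto_power_times_exp_at_top x) real_asymp
    then show "((F \<circ> real_of_ereal) \<longlongrightarrow> 0) (at_left \<infinity>)"
      by (simp add: ereal_tendsto_simps F_def[abs_def] mult_ac)
  qed simp
  ultimately have "real k * ((-1) ^ Suc k * Polygamma k x) + fact k / x ^ Suc k * erlang_mean k x
      - x * ((-1) ^ Suc (Suc k) * Polygamma (Suc k) x) = - (if k = 0 then 1 else 0)"
    by (simp add: interval_lebesgue_integral_0_infty)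
  then have "fact k / x ^ Suc k * erlang_mean k x =
      (-1) ^ k * (x * Polygamma (Suc k) x + real k * Polygamma k x - (if k = 0 then 1 else 0))"
    by (cases "k = 0") (auto simp: algebra_simps)
  then have "(-1) ^ k * (fact k / x ^ Suc k * erlang_mean k x) =
      x * Polygamma (Suc k) x + real k * Polygamma k x - (if k = 0 then 1 else 0)"
    by (simp only: left_minus_one_mult_self)
  moreover have "(-1) ^ k * (fact k / x ^ Suc k * erlang_mean k x) = (-1) ^ k * fact k / x ^ Suc k * erlang_mean k x"
    by simp
  ultimately show ?thesis by (rule trans[OF sym])
qed

section \<open>Iterated derivatives of Phi\<close>

text \<open>Identifies all iterates of \<open>deriv\<close> from a proposed sequence of derivatives.
  Openness of \<open>S\<close> lets equality on \<open>S\<close> determine the derivative at each of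
  its points.\<close>

lemma funpow_deriv_eq:
  fixes f :: "nat \<Rightarrow> real \<Rightarrow> real"
  assumes S: "open S" and g: "\<And>x. x \<in> S \<Longrightarrow> g x = f 0 x"
    and f: "\<And>k x. x \<in> S \<Longrightarrow> (f k has_real_derivative f (Suc k) x) (at x)"
    and x: "x \<in> S"
  shows "(deriv ^^ k) g x = f k x" "((deriv ^^ k) g has_real_derivative f (Suc k) x) (at x)"
proof -
  have eq: "(deriv ^^ k) g x = f k x" if "x \<in> S" for x
    using that
  proof (induction k arbitrary: x)
    case (Suc k)
    have "((deriv ^^ k) g has_real_derivative f (Suc k) x) (at x)"
      by (rule has_field_derivative_transform_within_open[OF f S]) (use Suc in auto)
    then show ?case by (simp add: DERIV_imp_deriv)
  qed (simp add: g)
  show "(deriv ^^ k) g x = f k x" using eq[OF x] .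
  show "((deriv ^^ k) g has_real_derivative f (Suc k) x) (at x)"
    by (rule has_field_derivative_transform_within_open[OF f S]) (use x eq in auto)
qed

lemma completely_monotonic_onI:
  fixes f :: "nat \<Rightarrow> real \<Rightarrow> real"
  assumes "open S" and "\<And>x. x \<in> S \<Longrightarrow> g x = f 0 x"
    and "\<And>k x. x \<in> S \<Longrightarrow> (f k has_real_derivative f (Suc k) x) (at x)"
    and "\<And>k x. x \<in> S \<Longrightarrow> 0 \<le> (-1) ^ k * f k x"
  shows "completely_monotonic_on S g"
  unfolding completely_monotonic_on_def
  using funpow_deriv_eq[OF assms(1-3)] assms(4) by (auto simp: real_differentiable_def) blast

text \<open>On the positive reals this is (-1)^k Phi^(k), by \<open>funpow_deriv_Phi\<close>;
  defining it through the Erlang mean makes its sign evident.\<close>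

definition abs_deriv_Phi :: "nat \<Rightarrow> real \<Rightarrow> real" where
  "abs_deriv_Phi k x = fact k / x ^ Suc k * erlang_mean k x"

lemma has_real_derivative_Polygamma_combination:
  fixes x :: real
  assumes "0 < x"
  shows "((\<lambda>x. x * Polygamma (Suc k) x + real k * Polygamma k x - (if k = 0 then 1 else 0)) has_real_derivative
    (x * Polygamma (Suc (Suc k)) x + real (Suc k) * Polygamma (Suc k) x - (if Suc k = 0 then 1 else 0))) (at x)"
proof -
  have "x \<notin> \<int>\<^sub>\<le>\<^sub>0" using assms by (auto elim!: nonpos_Ints_cases)
  then show ?thesis
    by (auto intro!: derivative_eq_intros simp: algebra_simps)
qed

lemma abs_deriv_Phi_Polygamma:
  assumes "0 < x"
  shows "abs_deriv_Phi k x =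
    (-1) ^ k * (x * Polygamma (Suc k) x + real k * Polygamma k x - (if k = 0 then 1 else 0))"
  unfolding Polygamma_erlang_mean[OF assms] abs_deriv_Phi_def by simp

lemma has_real_derivative_abs_deriv_Phi:
  assumes x: "0 < x"
  shows "(abs_deriv_Phi k has_real_derivative - abs_deriv_Phi (Suc k) x) (at x)"
proof (rule has_field_derivative_transform_within_open[where S = "{0<..}"])
  show "((\<lambda>x. (-1) ^ k * (x * Polygamma (Suc k) x + real k * Polygamma k x - (if k = 0 then 1 else 0)))
      has_real_derivative - abs_deriv_Phi (Suc k) x) (at x)"
    using DERIV_cmult[OF has_real_derivative_Polygamma_combination[OF x], of "(-1) ^ k" k]
    unfolding abs_deriv_Phi_Polygamma[OF x] by simp
qed (use x in \<open>auto simp: abs_deriv_Phi_Polygamma\<close>)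

lemma funpow_deriv_Phi:
  assumes x: "0 < x"
  shows "(deriv ^^ k) Phi x = (-1) ^ k * abs_deriv_Phi k x"
proof (rule funpow_deriv_eq(1)[where S = "{0<..}"])
  fix x :: real assume "x \<in> {0<..}"
  then have x: "0 < x" by simp
  have "x \<notin> \<int>\<^sub>\<le>\<^sub>0" using x by (auto elim!: nonpos_Ints_cases)
  then show "Phi x = (-1) ^ 0 * abs_deriv_Phi 0 x"
    by (simp add: Phi_def deriv_Polygamma abs_deriv_Phi_Polygamma[OF x])
  show "((\<lambda>x. (-1) ^ k * abs_deriv_Phi k x) has_real_derivative (-1) ^ Suc k * abs_deriv_Phi (Suc k) x) (at x)" for k
    using DERIV_cmult[OF has_real_derivative_abs_deriv_Phi[OF x], of "(-1) ^ k" k] by simp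
qed (use x in auto)

lemma abs_deriv_Phi_pos: "0 < x \<Longrightarrow> 0 < abs_deriv_Phi k x"
  using erlang_mean_bounds(1)[of x k] by (simp add: abs_deriv_Phi_def)

section \<open>Bounds and limits of the quotient\<close>

text \<open>For x > 0 this is the negative of the quotient in the theorem: the signs (-1)^(m+n+1)
  and (-1)^(m+n) leave a factor -1.\<close>

definition Phi_ratio :: "nat \<Rightarrow> nat \<Rightarrow> real \<Rightarrow> real" where
  "Phi_ratio m n x = abs_deriv_Phi (m + n + 1) x / (abs_deriv_Phi m x * abs_deriv_Phi n x)"

lemma Phi_ratio_erlang_mean:
  assumes "0 < x"
  shows "Phi_ratio m n x = fact (m + n + 1) / (fact m * fact n) *
    (erlang_mean (m + n + 1) x / (erlang_mean m x * erlang_mean n x))"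
  using assms erlang_mean_bounds(1)[of x m] erlang_mean_bounds(1)[of x n]
  by (simp add: Phi_ratio_def abs_deriv_Phi_def field_simps power_add)

lemma Phi_ratio_bounds:
  assumes x: "0 < x"
  shows "fact (m + n + 1) / (fact m * fact n) < Phi_ratio m n x"
    and "Phi_ratio m n x < 2 * fact (m + n + 1) / (fact m * fact n)"
proof -
  let ?c = "fact (m + n + 1) / (fact m * fact n) :: real"
  let ?q = "erlang_mean (m + n + 1) x / (erlang_mean m x * erlang_mean n x)"
  have c: "0 < ?c" by simp
  have "0 < erlang_mean m x * erlang_mean n x"
    using erlang_mean_bounds(1)[OF x, of m] erlang_mean_bounds(1)[OF x, of n] by simp
  with erlang_mean_sum_bounds[OF x, of m n] have "1 < ?q" "?q < 2"
    by (simp_all add: less_divide_eq divide_less_eq)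
  then have "?c * 1 < ?c * ?q" "?c * ?q < ?c * 2"
    using c by (simp_all only: mult_less_cancel_left_pos)
  then show "?c < Phi_ratio m n x" "Phi_ratio m n x < 2 * fact (m + n + 1) / (fact m * fact n)"
    unfolding Phi_ratio_erlang_mean[OF x] by (simp_all add: mult_ac)
qed

lemma tendsto_erlang_mean_at_top: "(erlang_mean k \<longlongrightarrow> 1 / 2) at_top"
proof (rule tendsto_sandwich)
  show "\<forall>\<^sub>F x in at_top. 1 / 2 \<le> erlang_mean k x"
    using eventually_gt_at_top[of 0] by eventually_elim (rule erlang_mean_bounds)
  show "\<forall>\<^sub>F x in at_top. erlang_mean k x \<le> 1 / 2 + real (k + 1) / (2 * x)"
    using eventually_gt_at_top[of 0] by eventually_elim (rule erlang_mean_bounds)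
  show "((\<lambda>x. 1 / 2 + real (k + 1) / (2 * x)) \<longlongrightarrow> 1 / 2) at_top" by real_asymp
qed simp

text \<open>The recurrence from x to x + 1 splits off the pole at 0. The remaining Polygamma values
  at x + 1 stay bounded and are multiplied by \<open>x ^ Suc k\<close>, so \<open>R\<close> tends to
  1.\<close>

lemma tendsto_erlang_mean_at_right_0: "(erlang_mean k \<longlongrightarrow> 1) (at_right 0)"
proof -
  define R where "R x = 1 + (-1) ^ k / fact k * x ^ Suc k *
      (x * Polygamma (Suc k) (x + 1) + real k * Polygamma k (x + 1) - (if k = 0 then 1 else 0))" for x :: real
  have "(0 + 1 :: real) \<notin> \<int>\<^sub>\<le>\<^sub>0" by simp
  then have "(R \<longlongrightarrow> 1 + (-1) ^ k / fact k * 0 ^ Suc k *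
      (0 * Polygamma (Suc k) (0 + 1) + real k * Polygamma k (0 + 1) - (if k = 0 then 1 else 0))) (at_right 0)"
    unfolding R_def by (intro tendsto_intros) auto
  then have "(R \<longlongrightarrow> 1) (at_right 0)" by simp
  moreover have "\<forall>\<^sub>F x in at_right 0. R x = erlang_mean k x"
    using eventually_at_right_less[of 0]
  proof eventually_elim
    fix x :: real assume x: "0 < x"
    \<comment> \<open>\<open>u\<close> is the factor of \<open>erlang_mean k x\<close> in
      \<open>Polygamma_erlang_mean\<close>. Replacing the arguments x of the Polygamma functions by
      x + 1 changes the combination by -(k + 1) u + k u = -u, which turns u E into u (E -
      1).\<close>
    define u where "u = (-1) ^ k * fact k / x ^ Suc k"
    have P: "Polygamma j (x + 1) = Polygamma j x + (-1) ^ j * fact j / x ^ Suc j" for j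
      using x by (intro Polygamma_plus1) simp
    have "x * Polygamma (Suc k) (x + 1) = x * Polygamma (Suc k) x - (real k + 1) * u"
      using x unfolding P u_def by (simp add: field_simps)
    moreover have "real k * Polygamma k (x + 1) = real k * Polygamma k x + real k * u"
      unfolding P u_def by (simp only: distrib_left)
    moreover have "(real k + 1) * u = real k * u + u" "u * (erlang_mean k x - 1) = u * erlang_mean k x - u"
      by (simp_all add: algebra_simps)
    ultimately have "x * Polygamma (Suc k) (x + 1) + real k * Polygamma k (x + 1) - (if k = 0 then 1 else 0)
      = u * (erlang_mean k x - 1)"
      using Polygamma_erlang_mean[OF x, of k] unfolding u_def[symmetric] by linarith
    moreover have "(-1) ^ k / fact k * x ^ Suc k * u = 1"
      using x by (simp add: u_def power_mult_distrib[symmetric])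
    ultimately show "R x = erlang_mean k x"
      unfolding R_def by (simp only: mult.assoc[symmetric]) simp
  qed
  ultimately show ?thesis by (rule Lim_transform_eventually)
qed

lemma Phi_ratio_limits:
  shows "(Phi_ratio m n \<longlongrightarrow> fact (m + n + 1) / (fact m * fact n)) (at_right 0)"
    and "(Phi_ratio m n \<longlongrightarrow> 2 * fact (m + n + 1) / (fact m * fact n)) at_top"
proof -
  let ?c = "fact (m + n + 1) / (fact m * fact n) :: real"
  let ?r = "\<lambda>x. ?c * (erlang_mean (m + n + 1) x / (erlang_mean m x * erlang_mean n x))"
  have "(?r \<longlongrightarrow> ?c * (1 / (1 * 1))) (at_right 0)"
    by (intro tendsto_intros tendsto_erlang_mean_at_right_0) simp
  moreover have "\<forall>\<^sub>F x in at_right 0. ?r x = Phi_ratio m n x"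
    using eventually_at_right_less[of 0] by eventually_elim (simp only: Phi_ratio_erlang_mean)
  ultimately show "(Phi_ratio m n \<longlongrightarrow> ?c) (at_right 0)"
    by (auto dest: Lim_transform_eventually)
  have "(?r \<longlongrightarrow> ?c * ((1 / 2) / (1 / 2 * (1 / 2)))) at_top"
    by (intro tendsto_intros tendsto_erlang_mean_at_top) simp
  then have "(?r \<longlongrightarrow> 2 * fact (m + n + 1) / (fact m * fact n)) at_top" by (simp add: mult_ac)
  moreover have "\<forall>\<^sub>F x in at_top. ?r x = Phi_ratio m n x"
    using eventually_gt_at_top[of 0] by eventually_elim (simp only: Phi_ratio_erlang_mean)
  ultimately show "(Phi_ratio m n \<longlongrightarrow> 2 * fact (m + n + 1) / (fact m * fact n)) at_top"
    by (rule Lim_transform_eventually)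
qed

text \<open>A bound on the whole half-line survives the limit at 0. Together with its counterpart at
  infinity this serves both the necessity parts and the sharpness.\<close>

lemma Phi_ratio_greatest_lower_bound:
  assumes "\<And>x. 0 < x \<Longrightarrow> d \<le> Phi_ratio m n x"
  shows "d \<le> fact (m + n + 1) / (fact m * fact n)"
  by (rule tendsto_lowerbound[OF Phi_ratio_limits(1)])
    (use assms in \<open>auto simp: eventually_at_filter\<close>)

lemma Phi_ratio_least_upper_bound:
  assumes "\<And>x. 0 < x \<Longrightarrow> Phi_ratio m n x \<le> d"
  shows "2 * fact (m + n + 1) / (fact m * fact n) \<le> d"
  by (rule tendsto_upperbound[OF Phi_ratio_limits(2)])
    (use assms in \<open>auto intro: eventually_mono[OF eventually_gt_at_top[of 0]]\<close>)

section \<open>Complete monotonicity of two-index families\<close>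

lemma completely_monotonic_family:
  fixes V :: "nat \<Rightarrow> nat \<Rightarrow> real \<Rightarrow> real"
  assumes nonneg: "\<And>m n x. 0 < x \<Longrightarrow> 0 \<le> V m n x"
    and deriv: "\<And>m n x. 0 < x \<Longrightarrow>
      (V m n has_real_derivative - (V (Suc m) n x + V m (Suc n) x)) (at x)"
    and g: "\<And>x. 0 < x \<Longrightarrow> g x = V m n x"
  shows "completely_monotonic_on {0<..} g"
proof -
  \<comment> \<open>\<open>U k m n\<close> is the k-th derivative of \<open>V m n\<close>. Iterating
    the operator on the whole family keeps its binomial expansion implicit; each step flips the sign
    of a sum of two members.\<close>
  define U where "U k = ((\<lambda>W m n x. - (W (Suc m) n x + W m (Suc n) x)) ^^ k) V" for k
  have U_0: "U 0 = V" and U_Suc: "U (Suc k) = (\<lambda>m n x. - (U k (Suc m) n x + U k m (Suc n) x))" for k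
    by (simp_all add: U_def)
  have U_deriv: "(U k m n has_real_derivative U (Suc k) m n x) (at x)" if "0 < x" for k m n x
    using that
  proof (induction k arbitrary: m n)
    case 0
    then show ?case by (simp only: U_Suc U_0 deriv)
  next
    case (Suc k)
    show ?case unfolding U_Suc[of "Suc k"] unfolding U_Suc[of k]
      by (rule DERIV_minus[OF DERIV_add]) (use Suc in \<open>simp_all add: U_Suc\<close>)
  qed
  have U_nonneg: "0 \<le> (-1) ^ k * U k m n x" if "0 < x" for k m n x
  proof (induction k arbitrary: m n)
    case 0
    then show ?case using that by (simp add: U_0 nonneg)
  next
    case (Suc k)
    show ?case using Suc[of "Suc m" n] Suc[of m "Suc n"] by (simp add: U_Suc algebra_simps)
  qed
  show ?thesis
    by (rule completely_monotonic_onI[where f = "\<lambda>k. U k m n"])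
      (use g U_deriv U_nonneg in \<open>auto simp: U_0\<close>)
qed

text \<open>Divided by the positive product of the two A-functions, the combination is p t + q with
  t in [1, 2]. An affine function is nonnegative there once it is so at both endpoints, and this is
  what the two hypotheses say.\<close>

lemma completely_monotonic_Phi_combination:
  fixes p q :: real
  assumes "0 \<le> p + q" "0 \<le> 2 * p + q"
    and g: "\<And>x. 0 < x \<Longrightarrow> g x = p * (fact m * fact n / fact (m + n + 1)) * abs_deriv_Phi (m + n + 1) x
      + q * (abs_deriv_Phi m x * abs_deriv_Phi n x)"
  shows "completely_monotonic_on {0<..} g"
proof -
  \<comment> \<open>This is the Beta value B(m + 1, n + 1), and \<open>a_split\<close> is its
    identity B(a, b) = B(a + 1, b) + B(a, b + 1).\<close>
  define a where "a m n = (fact m * fact n / fact (m + n + 1) :: real)" for m n :: nat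
  define V where "V m n x = p * a m n * abs_deriv_Phi (m + n + 1) x
      + q * (abs_deriv_Phi m x * abs_deriv_Phi n x)" for m n x
  have a_split: "a m n = a (Suc m) n + a m (Suc n)" for m n
  proof -
    have "a (Suc m) n + a m (Suc n) = (real m + real n + 2) * (fact m * fact n) / ((real m + real n + 2) * fact (m + n + 1))"
      by (simp add: a_def add_divide_distrib[symmetric] algebra_simps)
    then show ?thesis by (simp add: a_def)
  qed
  show ?thesis
  proof (rule completely_monotonic_family[of V])
    fix m n :: nat and x :: real assume x: "0 < x"
    define t where "t = a m n * Phi_ratio m n x"
    have P: "0 < abs_deriv_Phi m x * abs_deriv_Phi n x" using x by (simp add: abs_deriv_Phi_pos)
    then have R: "abs_deriv_Phi (m + n + 1) x = Phi_ratio m n x * (abs_deriv_Phi m x * abs_deriv_Phi n x)"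
      unfolding Phi_ratio_def by (metis less_irrefl nonzero_eq_divide_eq)
    have V: "V m n x = (p * t + q) * (abs_deriv_Phi m x * abs_deriv_Phi n x)"
      unfolding V_def t_def R by (simp only: algebra_simps)
    have "1 \<le> t" "t \<le> 2"
      using Phi_ratio_bounds[OF x, of m n] by (simp_all add: t_def a_def field_simps)
    \<comment> \<open>The sum of these two products is p t + q.\<close>
    then have "0 \<le> (2 - t) * (p + q)" "0 \<le> (t - 1) * (2 * p + q)"
      using assms(1,2) by simp_all
    then have "0 \<le> p * t + q" by (simp add: algebra_simps)
    then show "0 \<le> V m n x" unfolding V by (rule mult_nonneg_nonneg[OF _ less_imp_le[OF P]])
    show "(V m n has_real_derivative - (V (Suc m) n x + V m (Suc n) x)) (at x)"
      unfolding V_def using a_split[of m n]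
      by (auto intro!: derivative_eq_intros has_real_derivative_abs_deriv_Phi x simp: algebra_simps)
  qed (simp add: g V_def a_def)
qed

theorem theorem2:
  fixes m n :: nat and \<omega> :: real
  shows
    "(completely_monotonic_on {0<..} (\<lambda>x. (-1) ^ (m + n + 1) * Y m n \<omega> x)
        \<longleftrightarrow> \<omega> \<le> fact (m + n + 1) / (fact m * fact n)) \<and>
     (completely_monotonic_on {0<..} (\<lambda>x. (-1) ^ (m + n) * Y m n \<omega> x)
        \<longleftrightarrow> \<omega> \<ge> 2 * fact (m + n + 1) / (fact m * fact n)) \<and>
     (\<forall>x>0.
        - (2 * fact (m + n + 1) / (fact m * fact n))
          < (deriv ^^ (m + n + 1)) Phi x / ((deriv ^^ m) Phi x * (deriv ^^ n) Phi x) \<and>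
        (deriv ^^ (m + n + 1)) Phi x / ((deriv ^^ m) Phi x * (deriv ^^ n) Phi x)
          < - (fact (m + n + 1) / (fact m * fact n))) \<and>
     (\<forall>c > - (2 * fact (m + n + 1) / (fact m * fact n)).
        \<not> (\<forall>x>0. c < (deriv ^^ (m + n + 1)) Phi x / ((deriv ^^ m) Phi x * (deriv ^^ n) Phi x))) \<and>
     (\<forall>c < - (fact (m + n + 1) / (fact m * fact n)).
        \<not> (\<forall>x>0. (deriv ^^ (m + n + 1)) Phi x / ((deriv ^^ m) Phi x * (deriv ^^ n) Phi x) < c))"
proof -
  let ?A = abs_deriv_Phi
  define c where "c = (fact (m + n + 1) / (fact m * fact n) :: real)"
  have c2: "2 * fact (m + n + 1) / (fact m * fact n) = 2 * c" by (simp add: c_def)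
  have c_pos: "0 < c" by (simp add: c_def)
  have ca: "c * (fact m * fact n / fact (m + n + 1)) = 1" by (simp add: c_def)
  have ratio: "(deriv ^^ (m + n + 1)) Phi x / ((deriv ^^ m) Phi x * (deriv ^^ n) Phi x) = - Phi_ratio m n x"
    if "0 < x" for x
    unfolding funpow_deriv_Phi[OF that] by (simp add: Phi_ratio_def power_add field_simps)
  have Y1: "(-1) ^ (m + n + 1) * Y m n \<omega> x = ?A (m + n + 1) x - \<omega> * (?A m x * ?A n x)" if "0 < x" for x
    unfolding Y_def funpow_deriv_Phi[OF that]
    by (simp add: power_add algebra_simps flip: power_mult_distrib)
  have Y2: "(-1) ^ (m + n) * Y m n \<omega> x = \<omega> * (?A m x * ?A n x) - ?A (m + n + 1) x" if "0 < x" for x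
    using Y1[OF that] by simp
  have Y_sign: "0 \<le> ?A (m + n + 1) x - \<omega> * (?A m x * ?A n x) \<longleftrightarrow> \<omega> \<le> Phi_ratio m n x"
    "0 \<le> \<omega> * (?A m x * ?A n x) - ?A (m + n + 1) x \<longleftrightarrow> Phi_ratio m n x \<le> \<omega>" if "0 < x" for x
    using abs_deriv_Phi_pos[OF that, of m] abs_deriv_Phi_pos[OF that, of n]
    by (simp_all add: Phi_ratio_def le_divide_eq divide_le_eq)
  \<comment> \<open>The case k = 0 of complete monotonicity; through \<open>Y_sign\<close> it turns
    into a bound on \<open>Phi_ratio\<close> and so yields the necessity of both conditions.\<close>
  have cm_nonneg: "0 \<le> f x" if "completely_monotonic_on {0<..} f" "0 < x" for f x
    using that unfolding completely_monotonic_on_def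
    by (metis funpow_0 greaterThan_iff mult_1 power_0)
  have "\<omega> \<le> c" if cm: "completely_monotonic_on {0<..} (\<lambda>x. (-1) ^ (m + n + 1) * Y m n \<omega> x)"
    unfolding c_def
  proof (rule Phi_ratio_greatest_lower_bound)
    fix x :: real assume x: "0 < x"
    from cm_nonneg[OF cm x] show "\<omega> \<le> Phi_ratio m n x"
      by (simp only: Y1[OF x] Y_sign(1)[OF x])
  qed
  moreover have "completely_monotonic_on {0<..} (\<lambda>x. (-1) ^ (m + n + 1) * Y m n \<omega> x)" if "\<omega> \<le> c"
  \<comment> \<open>By \<open>ca\<close> the choice \<open>p = c\<close> cancels the Beta factor.
    The endpoint conditions read \<omega> \<le> c and \<omega> \<le> 2 c, so the first
    decides.\<close>
  proof (rule completely_monotonic_Phi_combination[where m = m and n = n and p = c and q = "- \<omega>"])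
    show "0 \<le> c + - \<omega>" "0 \<le> 2 * c + - \<omega>" using that c_pos by auto
  qed (simp only: Y1 ca mult_1 mult_minus_left diff_conv_add_uminus)
  moreover have "2 * c \<le> \<omega>" if cm: "completely_monotonic_on {0<..} (\<lambda>x. (-1) ^ (m + n) * Y m n \<omega> x)"
    unfolding c2[symmetric]
  proof (rule Phi_ratio_least_upper_bound)
    fix x :: real assume x: "0 < x"
    from cm_nonneg[OF cm x] show "Phi_ratio m n x \<le> \<omega>"
      by (simp only: Y2[OF x] Y_sign(2)[OF x])
  qed
  moreover have "completely_monotonic_on {0<..} (\<lambda>x. (-1) ^ (m + n) * Y m n \<omega> x)" if "2 * c \<le> \<omega>"
  \<comment> \<open>With the signs reversed the endpoint conditions are \<omega> \<ge> c and
    \<omega> \<ge> 2 c, and now the second decides.\<close>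
  proof (rule completely_monotonic_Phi_combination[where m = m and n = n and p = "- c" and q = \<omega>])
    show "0 \<le> - c + \<omega>" "0 \<le> 2 * - c + \<omega>" using that c_pos by auto
  qed (simp only: Y2 ca mult_1 mult_minus_left; simp)
  moreover have "- (2 * c) < - Phi_ratio m n x" "- Phi_ratio m n x < - c" if "0 < x" for x
    using Phi_ratio_bounds[OF that, of m n] by (simp_all add: c_def)
  moreover have "\<not> (\<forall>x>0. d < - Phi_ratio m n x)" if "- (2 * c) < d" for d
    using Phi_ratio_least_upper_bound[of m n "- d"] that unfolding c2 by force
  moreover have "\<not> (\<forall>x>0. - Phi_ratio m n x < d)" if "d < - c" for d
    using Phi_ratio_greatest_lower_bound[of "- d" m n] that unfolding c_def[symmetric] by force
  ultimately have "(completely_monotonic_on {0<..} (\<lambda>x. (-1) ^ (m + n + 1) * Y m n \<omega> x) \<longleftrightarrow> \<omega> \<le> c) \<and>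
      (completely_monotonic_on {0<..} (\<lambda>x. (-1) ^ (m + n) * Y m n \<omega> x) \<longleftrightarrow> \<omega> \<ge> 2 * c) \<and>
      (\<forall>x>0. - (2 * c) < - Phi_ratio m n x \<and> - Phi_ratio m n x < - c) \<and>
      (\<forall>d > - (2 * c). \<not> (\<forall>x>0. d < - Phi_ratio m n x)) \<and>
      (\<forall>d < - c. \<not> (\<forall>x>0. - Phi_ratio m n x < d))"
    by blast
  then show ?thesis
    unfolding c2 unfolding c_def[symmetric] by (simp only: ratio simp_thms cong: imp_cong)
qed

end
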